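(* Let $x_L < x_R$ be real numbers, let $\mathbf{x} = [x_1,\dots,x_N]^T$ be a vector of grid points in $[x_L,x_R]$ with $x_1 = x_L$ and $x_N = x_R$, and let $\mathcal{F} \subset C^1([x_L,x_R])$ be a finite-dimensional (real) function space with basis $\{f_1,\dots,f_K\}$. Assume that the $N \times K$ Vandermonde-like matrix $$F = [f_1(\mathbf{x}),\dots,f_K(\mathbf{x})] = \big(f_k(x_n)\big)_{1\le n\le N,\ 1\le k\le K}$$ has linearly independent columns. Let $\mathbf{p} = [p_1,\dots,p_N]^T \in \mathbb{R}^N$. Then there exists an $\mathcal{F}$-based SBP operator $D = P^{-1}Q$ (on the grid $\mathbf{x}$) with positive definite diagonal norm matrix $P = \operatorname{diag}(\mathbf{p})$ if and only if the quadrature formula $I_{\mathbf{x},\mathbf{p}}$ with points $\mathbf{x}$ and weights $\mathbf{p}$ is positive and $(\mathcal{F}\mathcal{F})'$-exact. In particular, on the grid $\mathbf{x}$ a diagonal-norm $\mathcal{F}$-based SBP operator exists if and only if a positive and $(\mathcal{F}\mathcal{F})'$-exact quadrature formula with points $\mathbf{x}$ exists.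
   Context: For $f \in C^1([x_L,x_R])$ write $f(\mathbf{x}) = [f(x_1),\dots,f(x_N)]^T$ and $f'(\mathbf{x}) = [f'(x_1),\dots,f'(x_N)]^T$. $\mathcal{F}$-based SBP (summation-by-parts) operator: a real $N\times N$ matrix $D = P^{-1}Q$, with $P,Q \in \mathbb{R}^{N\times N}$, such that (i) $D f(\mathbf{x}) = f'(\mathbf{x})$ for all $f \in \mathcal{F}$; (ii) $P$ is symmetric positive definite; (iii) $Q + Q^T = B := \operatorname{diag}(-1,0,\dots,0,1)$. The matrix $P$ is called the norm matrix, and the operator is called diagonal-norm if $P$ is diagonal. Quadrature formula: for points $\mathbf{x}=[x_1,\dots,x_N]^T$ in $[x_L,x_R]$ and weights $\mathbf{w}=[w_1,\dots,w_N]^T \in \mathbb{R}^N$, $I_{\mathbf{x},\mathbf{w}}[f] = \sum_{n=1}^N w_n f(x_n)$. It is positive if $w_n > 0$ for all $n=1,\dots,N$. For a set $\mathcal{G}$ of continuous functions on $[x_L,x_R]$ it is $\mathcal{G}$-exact if $I_{\mathbf{x},\mathbf{w}}[g] = \int_{x_L}^{x_R} g(x)\,dx$ for all $g \in \mathcal{G}$. $(\mathcal{F}\mathcal{F})' = \{ (fg)' \mid f,g \in \mathcal{F} \}$. *)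

theory Defs
  imports
    "HOL-Analysis.Analysis"
    "HOL-Library.Function_Algebras"
    "Jordan_Normal_Form.DL_Rank"
begin

unbundle no vec_syntax

section \<open>Real functions on a compact interval\<close>

text \<open>
  A real function on \<open>[a, b]\<close> is represented by its extension by zero to the whole
  real line.  This representation is injective and respects pointwise sums, scalar multiples and
  products, so that linear algebra on function spaces over \<open>[a, b]\<close> is linear algebra in
  the real vector space of all functions from the reals to the reals.
\<close>

global_interpretation fun_space: vector_space "\<lambda>(c::real) (f::real \<Rightarrow> real) t. c * f t"
  by unfold_locales (auto simp: fun_eq_iff algebra_simps)

text \<open>The derivative on \<open>[a, b]\<close> is one-sided at the end points.\<close>

definition deriv_on :: "real \<Rightarrow> real \<Rightarrow> (real \<Rightarrow> real) \<Rightarrow> real \<Rightarrow> real" where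
  "deriv_on a b f t =
     (if t \<in> {a..b} then vector_derivative f (at t within {a..b}) else 0)"

definition C1_on :: "real \<Rightarrow> real \<Rightarrow> (real \<Rightarrow> real) set" where
  "C1_on a b = {f. (\<forall>t. t \<notin> {a..b} \<longrightarrow> f t = 0) \<and>
     f differentiable_on {a..b} \<and> continuous_on {a..b} (deriv_on a b f)}"

definition is_basis :: "(real \<Rightarrow> real) list \<Rightarrow> (real \<Rightarrow> real) set \<Rightarrow> bool" where
  "is_basis fs \<F> \<longleftrightarrow>
     distinct fs \<and> fun_space.independent (set fs) \<and> fun_space.span (set fs) = \<F>"

definition product_derivs ::
    "real \<Rightarrow> real \<Rightarrow> (real \<Rightarrow> real) set \<Rightarrow> (real \<Rightarrow> real) set" where
  "product_derivs a b \<F> = {deriv_on a b (\<lambda>t. f t * g t) | f g. f \<in> \<F> \<and> g \<in> \<F>}"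


section \<open>Summation-by-parts operators\<close>

text \<open>
  Indices are zero-based: the grid points \<open>x\<^sub>1, \<dots>, x\<^sub>N\<close> are the components
  \<open>0, \<dots>, N - 1\<close> of a vector.  The values \<open>f(x)\<close> of a function on the
  grid are \<open>map_vec f x\<close>.
\<close>

definition vandermonde_like :: "(real \<Rightarrow> real) list \<Rightarrow> real vec \<Rightarrow> real mat" where
  "vandermonde_like fs x = Matrix.mat (dim_vec x) (length fs) (\<lambda>(n, k). (fs ! k) (x $ n))"

text \<open>
  Distinctness of the list of columns makes this linear independence of the columns as an
  indexed family.
\<close>

definition lin_indpt_cols :: "real mat \<Rightarrow> bool" where
  "lin_indpt_cols A \<longleftrightarrow> distinct (cols A) \<and>
     \<not> LinearCombinations.module.lin_dep class_ring (module_vec TYPE(real) (dim_row A))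
         (set (cols A))"

definition sym_pos_def :: "real mat \<Rightarrow> bool" where
  "sym_pos_def P \<longleftrightarrow> square_mat P \<and> transpose_mat P = P \<and>
     (\<forall>v\<in>carrier_vec (dim_row P). v \<noteq> 0\<^sub>v (dim_row P) \<longrightarrow>
        scalar_prod v (P *\<^sub>v v) > 0)"

definition boundary_mat :: "nat \<Rightarrow> real mat" where
  "boundary_mat N = mat_diag N (\<lambda>n. if n = 0 then -1 else if n = N - 1 then 1 else 0)"

definition sbp_operator ::
    "real \<Rightarrow> real \<Rightarrow> real vec \<Rightarrow> (real \<Rightarrow> real) set \<Rightarrow>
     real mat \<Rightarrow> real mat \<Rightarrow> real mat \<Rightarrow> bool" where
  "sbp_operator a b x \<F> D P Q \<longleftrightarrow> (let N = dim_vec x in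
     P \<in> carrier_mat N N \<and> Q \<in> carrier_mat N N \<and>
     (\<exists>P_inv \<in> carrier_mat N N.
        inverts_mat P P_inv \<and> inverts_mat P_inv P \<and> D = P_inv * Q) \<and>
     (\<forall>f\<in>\<F>. D *\<^sub>v map_vec f x = map_vec (deriv_on a b f) x) \<and>
     sym_pos_def P \<and>
     Q + transpose_mat Q = boundary_mat N)"


section \<open>Quadrature formulas\<close>

definition quadrature :: "real vec \<Rightarrow> real vec \<Rightarrow> (real \<Rightarrow> real) \<Rightarrow> real" where
  "quadrature x w f = (\<Sum>n<dim_vec x. w $ n * f (x $ n))"

definition positive_quadrature :: "real vec \<Rightarrow> bool" where
  "positive_quadrature w \<longleftrightarrow> (\<forall>n<dim_vec w. w $ n > 0)"

definition exact_quadrature ::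
    "real \<Rightarrow> real \<Rightarrow> real vec \<Rightarrow> real vec \<Rightarrow> (real \<Rightarrow> real) set \<Rightarrow> bool" where
  "exact_quadrature a b x w \<G> \<longleftrightarrow> (\<forall>g\<in>\<G>. quadrature x w g = integral {a..b} g)"

end

theory Submission
  imports Defs
begin

text \<open>
  Pairing \<open>Q f(x) = P f'(x)\<close> with \<open>g(x)\<close> and symmetrising gives
  \<open>\<Sum>\<^sub>n p\<^sub>n (fg)'(x\<^sub>n) = g(x)\<^sup>T (Q + Q\<^sup>T) f(x) = [fg]\<close>, the boundary term of
  \<open>fg\<close>, which is the integral of \<open>(fg)'\<close>.  Conversely, put \<open>Q = S + B/2\<close>.  The unknown
  \<open>S\<close> must be skew with \<open>S F = R := P F' - B F / 2\<close>, and exactness says precisely that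
  \<open>R\<^sup>T F\<close> is skew.  As \<open>F\<close> has a left inverse \<open>G\<close>,
  \<open>S = R G - (R G)\<^sup>T + G\<^sup>T R\<^sup>T F G\<close> is a solution.
\<close>

section \<open>Matrix completion\<close>

text \<open>The squared norm of \<open>A *\<^sub>v v\<close> is the pairing of \<open>v\<close> with
  its Gram image, so over the reals the Gram matrix has no larger kernel than
  \<open>A\<close>.\<close>

lemma gram_mat_vec_eq_0:
  fixes A :: "real mat"
  assumes A: "A \<in> carrier_mat n k" and v: "v \<in> carrier_vec k"
    and 0: "(transpose_mat A * A) *\<^sub>v v = 0\<^sub>v k"
  shows "A *\<^sub>v v = 0\<^sub>v n"
proof -
  have Av: "A *\<^sub>v v \<in> carrier_vec n" using A v by auto
  have "scalar_prod (A *\<^sub>v v) (A *\<^sub>v v) = scalar_prod (transpose_mat A *\<^sub>v (A *\<^sub>v v)) v"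
    using transpose_vec_mult_scalar[OF A v Av] by simp
  also have "transpose_mat A *\<^sub>v (A *\<^sub>v v) = 0\<^sub>v k"
    using 0 A v by (simp add: assoc_mult_mat_vec[of _ k n _ k])
  finally have "scalar_prod (A *\<^sub>v v) (A *\<^sub>v v) = 0" using v by simp
  \<comment> \<open>Conjugation on the reals is the identity, so a vector orthogonal to itself
    vanishes.\<close>
  then show ?thesis
    using Av conjugate_square_eq_0_vec[OF Av] by simp
qed

text \<open>The left inverse is the pseudo-inverse, the inverse Gram matrix times the transpose of
  \<open>A\<close>. A kernel vector of the Gram matrix would be a linear relation between the
  columns; distinctness of the columns makes it a relation on the set
  \<open>set (cols A)\<close>.\<close>

lemma lin_indpt_cols_left_inverse:
  assumes A: "A \<in> carrier_mat n k" and li: "lin_indpt_cols A"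
  obtains G where "G \<in> carrier_mat k n" "G * A = 1\<^sub>m k"
proof -
  interpret vec_space "TYPE(real)" n .
  let ?C = "transpose_mat A * A"
  have C: "?C \<in> carrier_mat k k" using A by auto
  have "det ?C \<noteq> 0"
  proof
    assume "det ?C = 0"
    then obtain v where v: "v \<in> carrier_vec k" "v \<noteq> 0\<^sub>v k" "?C *\<^sub>v v = 0\<^sub>v k"
      using det_0_iff_vec_prod_zero[OF C] by auto
    then have "A *\<^sub>v v = 0\<^sub>v n"
      using gram_mat_vec_eq_0[OF A] by auto
    then have "lin_dep (set (cols A))"
      using lin_depI[OF A v(1,2)] li by (auto simp: lin_indpt_cols_def)
    then show False
      using li A by (auto simp: lin_indpt_cols_def)
  qed
  then obtain H where H: "H \<in> carrier_mat k k" "H * ?C = 1\<^sub>m k"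
    using det_non_zero_imp_unit[OF C] by (force simp: Units_def ring_mat_def)
  show thesis
  proof
    show "H * transpose_mat A \<in> carrier_mat k n" using H A by auto
    show "H * transpose_mat A * A = 1\<^sub>m k"
      using H A by (simp add: assoc_mult_mat[of _ k k _ n _ k])
  qed
qed

text \<open>The skewness condition is forced: if \<open>S\<close> is skew and
  \<open>S * F = R\<close>, then R^T F = - F^T S F is skew. Conversely, \<open>A = R * G\<close>
  already maps \<open>F\<close> to \<open>R\<close>; subtracting its transpose makes it skew but
  spoils the product with \<open>F\<close> by A^T F = G^T M. The term \<open>X\<close>, skew because
  \<open>M\<close> is, restores exactly this.\<close>

lemma skew_completion:
  fixes F R :: "real mat"
  assumes F: "F \<in> carrier_mat n k" and R: "R \<in> carrier_mat n k"
    and li: "lin_indpt_cols F"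
    and skew: "transpose_mat (transpose_mat R * F) = - (transpose_mat R * F)"
  obtains S where "S \<in> carrier_mat n n" "transpose_mat S = - S" "S * F = R"
proof -
  obtain G where G: "G \<in> carrier_mat k n" "G * F = 1\<^sub>m k"
    using lin_indpt_cols_left_inverse[OF F li] .
  define A where "A = R * G"
  define M where "M = transpose_mat R * F"
  define X where "X = transpose_mat G * M * G"
  have Gt: "transpose_mat G \<in> carrier_mat n k" using G by simp
  have A: "A \<in> carrier_mat n n" "transpose_mat A \<in> carrier_mat n n" using R G by (auto simp: A_def)
  have M: "M \<in> carrier_mat k k" using R F by (auto simp: M_def)
  have GM: "transpose_mat G * M \<in> carrier_mat n k" using Gt M by auto
  have X: "X \<in> carrier_mat n n" using GM G by (auto simp: X_def)
  have AF: "A * F = R"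
    using R G F by (simp add: A_def assoc_mult_mat[of _ n k _ n _ k])
  have "X * F = transpose_mat G * M"
    using G F by (simp add: X_def assoc_mult_mat[OF GM G(1) F] right_mult_one_mat[OF GM])
  also have "\<dots> = transpose_mat A * F"
    using Gt R F G by (simp add: A_def M_def transpose_mult[OF R G(1)] assoc_mult_mat[of _ n k _ n _ k])
  finally have XF: "X * F = transpose_mat A * F" .
  have "transpose_mat X = transpose_mat G * (transpose_mat M * G)"
    unfolding X_def by (subst transpose_mult[OF GM G(1)], subst transpose_mult[OF Gt M], simp)
  also have "\<dots> = - X"
    using skew Gt M G by (simp add: X_def M_def[symmetric] assoc_mult_mat[of _ n k _ k _ n])
  finally have Xt: "transpose_mat X = - X" .
  let ?S = "A - transpose_mat A + X"
  show thesis
  proof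
    show S: "?S \<in> carrier_mat n n" using A X by auto
    show "transpose_mat ?S = - ?S"
    proof (rule eq_matI)
      fix i j assume ij: "i < dim_row (- ?S)" "j < dim_col (- ?S)"
      then have "X $$ (j, i) = - X $$ (i, j)"
        using X arg_cong[OF Xt, of "\<lambda>Y. Y $$ (i, j)"] by simp
      then show "transpose_mat ?S $$ (i, j) = (- ?S) $$ (i, j)"
        using ij A X by simp
    qed (use A X in auto)
    have "?S * F = A * F - transpose_mat A * F + X * F"
      using A X F by (subst add_mult_distrib_mat[of _ n n _ _ k], auto simp: minus_mult_distrib_mat[of _ n n _ _ k])
    also have "\<dots> = R"
      unfolding AF XF using A F R by (intro eq_matI) auto
    finally show "?S * F = R" .
  qed
qed

section \<open>Diagonal matrices and the boundary form\<close>

lemma smult_mat_mult_vec: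
  fixes A :: "'a :: semiring_0 mat"
  assumes "A \<in> carrier_mat n k" "v \<in> carrier_vec k"
  shows "(c \<cdot>\<^sub>m A) *\<^sub>v v = c \<cdot>\<^sub>v (A *\<^sub>v v)"
  using assms by (intro eq_vecI) (auto simp: scalar_prod_def sum_distrib_left mult.assoc)

lemma mat_diag_mult_vec:
  assumes "v \<in> carrier_vec n"
  shows "mat_diag n d *\<^sub>v v = vec n (\<lambda>i. d i * (v $ i :: 'a :: semiring_1))"
proof (rule eq_vecI)
  fix i assume "i < dim_vec (vec n (\<lambda>i. d i * v $ i))"
  then have i: "i < n" by simp
  have "(mat_diag n d *\<^sub>v v) $ i = (\<Sum>j\<in>{0..<n}. (if i = j then d j else 0) * v $ j)"
    using i assms by (simp add: mat_diag_def scalar_prod_def)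
  also have "\<dots> = d i * v $ i"
    using i by (subst sum.remove[of _ i]) auto
  finally show "(mat_diag n d *\<^sub>v v) $ i = vec n (\<lambda>i. d i * v $ i) $ i"
    using i by simp
qed (simp add: mat_diag_def)

lemma scalar_prod_boundary_mat:
  assumes "u \<in> carrier_vec N" "v \<in> carrier_vec N" "N \<ge> 2"
  shows "scalar_prod u (boundary_mat N *\<^sub>v v) = u $ (N - 1) * v $ (N - 1) - u $ 0 * v $ 0"
proof -
  let ?b = "\<lambda>n. if n = 0 then -1 else if n = N - 1 then 1 else (0::real)"
  have "scalar_prod u (boundary_mat N *\<^sub>v v) = (\<Sum>n\<in>{0..<N}. u $ n * (?b n * v $ n))"
    unfolding boundary_mat_def mat_diag_mult_vec[OF assms(2)] by (simp add: scalar_prod_def)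
  \<comment> \<open>The nested conditional becomes a difference of two indicators only because
    \<open>N \<ge> 2\<close> separates the indices 0 and \<open>N - 1\<close>.\<close>
  also have "\<dots> = (\<Sum>n\<in>{0..<N}. (if n = N - 1 then u $ n * v $ n else 0) - (if n = 0 then u $ n * v $ n else 0))"
    using assms by (intro sum.cong) auto
  also have "\<dots> = u $ (N - 1) * v $ (N - 1) - u $ 0 * v $ 0"
    using assms by (simp add: sum_subtractf)
  finally show ?thesis .
qed

section \<open>Derivatives on an interval\<close>

text \<open>A nondegenerate interval makes the derivative within it unique, also at the end
  points.\<close>

lemma deriv_on_eqI:
  assumes "a < b" "t \<in> {a..b}" "(f has_vector_derivative d) (at t within {a..b})"
  shows "deriv_on a b f t = d"
  using assms vector_derivative_within_cbox[of a b t f d] by (simp add: deriv_on_def)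

lemma has_vector_derivative_deriv_on:
  assumes "f differentiable_on {a..b}" "t \<in> {a..b}"
  shows "(f has_vector_derivative deriv_on a b f t) (at t within {a..b})"
  using assms by (auto simp: deriv_on_def differentiable_on_def vector_derivative_works)

lemma deriv_on_mult:
  assumes "a < b" "f differentiable_on {a..b}" "g differentiable_on {a..b}" "t \<in> {a..b}"
  shows "deriv_on a b (\<lambda>t. f t * g t) t = f t * deriv_on a b g t + deriv_on a b f t * g t"
  using assms
  by (intro deriv_on_eqI has_vector_derivative_mult has_vector_derivative_deriv_on)

lemma integral_deriv_on:
  assumes "a < b" "h differentiable_on {a..b}"
  shows "integral {a..b} (deriv_on a b h) = h b - h a"
  using assms
  by (intro integral_unique fundamental_theorem_of_calculus has_vector_derivative_deriv_on) auto

section \<open>Summation by parts and quadrature\<close>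

text \<open>Unit vectors isolate the diagonal entries. Conversely, the quadratic form is a weighted
  sum of squares, with a positive summand at any nonzero component. This is how definiteness of the
  norm matrix becomes positivity of the weights.\<close>

lemma sym_pos_def_mat_diag_iff:
  "sym_pos_def (mat_diag n d) \<longleftrightarrow> (\<forall>i<n. d i > 0)"
proof
  assume spd: "sym_pos_def (mat_diag n d)"
  show "\<forall>i<n. d i > 0"
  proof (intro allI impI)
    fix i assume i: "i < n"
    have "scalar_prod (unit_vec n i) (mat_diag n d *\<^sub>v unit_vec n i) > 0"
      using spd i unit_vec_nonzero[OF i] by (simp add: sym_pos_def_def mat_diag_def)
    then show "d i > 0" using i by (simp add: mat_diag_mult_vec)
  qed
next
  assume d: "\<forall>i<n. d i > 0"
  have "scalar_prod v (mat_diag n d *\<^sub>v v) > 0" if v: "v \<in> carrier_vec n" "v \<noteq> 0\<^sub>v n" for v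
  proof -
    obtain i where i: "i < n" "v $ i \<noteq> 0" using v by (metis carrier_vecD eq_vecI index_zero_vec)
    have "scalar_prod v (mat_diag n d *\<^sub>v v) = (\<Sum>i\<in>{0..<n}. d i * (v $ i)\<^sup>2)"
      using v by (simp add: mat_diag_mult_vec scalar_prod_def power2_eq_square mult.left_commute)
    also have "\<dots> > 0"
      using i d by (intro sum_pos2[of _ i]) (auto simp: less_imp_le)
    finally show ?thesis .
  qed
  moreover have "transpose_mat (mat_diag n d) = mat_diag n d"
    by (rule eq_matI) (auto simp: mat_diag_def)
  ultimately show "sym_pos_def (mat_diag n d)"
    by (auto simp: sym_pos_def_def mat_diag_def)
qed

section \<open>Grids that contain both end points\<close>

locale grid =
  fixes a b :: real and N :: nat and x :: "real vec"
  assumes ab: "a < b" and x: "x \<in> carrier_vec N"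
    and x_in: "\<And>n. n < N \<Longrightarrow> x $ n \<in> {a..b}"
    and x_first: "x $ 0 = a" and x_last: "x $ (N - 1) = b"
begin

lemma N_ge_2: "N \<ge> 2"
proof (rule ccontr)
  assume "\<not> N \<ge> 2"
  \<comment> \<open>Truncated subtraction covers \<open>N = 0\<close> and \<open>N = 1\<close> at
    once: the first and last points would coincide.\<close>
  then have "N - 1 = 0" by simp
  then show False using x_first x_last ab by simp
qed

text \<open>The product rule splits the quadrature of (fg)' into f(x)^T P g'(x) + g(x)^T P f'(x).
  The fundamental theorem turns its integral into the boundary values of fg, which the boundary
  matrix reads off at the first and last grid points. Both directions of the main equivalence work
  with this bilinear form of exactness.\<close>

lemma exact_quadrature_iff:
  assumes diff: "\<forall>f\<in>\<F>. f differentiable_on {a..b}"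
  shows "exact_quadrature a b x p (product_derivs a b \<F>) \<longleftrightarrow>
    (\<forall>f\<in>\<F>. \<forall>g\<in>\<F>.
      (\<Sum>n<N. f (x $ n) * (p $ n * deriv_on a b g (x $ n))) +
      (\<Sum>n<N. g (x $ n) * (p $ n * deriv_on a b f (x $ n))) =
      scalar_prod (map_vec f x) (boundary_mat N *\<^sub>v map_vec g x))"
proof -
  have "quadrature x p (deriv_on a b (\<lambda>t. f t * g t)) =
      (\<Sum>n<N. f (x $ n) * (p $ n * deriv_on a b g (x $ n))) +
      (\<Sum>n<N. g (x $ n) * (p $ n * deriv_on a b f (x $ n)))"
    "integral {a..b} (deriv_on a b (\<lambda>t. f t * g t)) =
      scalar_prod (map_vec f x) (boundary_mat N *\<^sub>v map_vec g x)"
    if f: "f \<in> \<F>" and g: "g \<in> \<F>" for f g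
  proof -
    show "quadrature x p (deriv_on a b (\<lambda>t. f t * g t)) =
      (\<Sum>n<N. f (x $ n) * (p $ n * deriv_on a b g (x $ n))) +
      (\<Sum>n<N. g (x $ n) * (p $ n * deriv_on a b f (x $ n)))"
      unfolding quadrature_def sum.distrib[symmetric]
      using x by (intro sum.cong)
        (auto simp: deriv_on_mult[OF ab diff[rule_format, OF f] diff[rule_format, OF g] x_in] algebra_simps)
    have "(\<lambda>t. f t * g t) differentiable_on {a..b}"
      using diff f g by (auto simp: differentiable_on_def intro!: differentiable_mult)
    then show "integral {a..b} (deriv_on a b (\<lambda>t. f t * g t)) =
        scalar_prod (map_vec f x) (boundary_mat N *\<^sub>v map_vec g x)"
      using x N_ge_2 x_first x_last
      by (simp add: integral_deriv_on[OF ab] scalar_prod_boundary_mat)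
  qed
  then have "quadrature x p (deriv_on a b (\<lambda>t. f t * g t)) = integral {a..b} (deriv_on a b (\<lambda>t. f t * g t)) \<longleftrightarrow>
      (\<Sum>n<N. f (x $ n) * (p $ n * deriv_on a b g (x $ n))) +
      (\<Sum>n<N. g (x $ n) * (p $ n * deriv_on a b f (x $ n))) =
      scalar_prod (map_vec f x) (boundary_mat N *\<^sub>v map_vec g x)" if "f \<in> \<F>" "g \<in> \<F>" for f g
    using that by simp
  moreover have "exact_quadrature a b x p (product_derivs a b \<F>) \<longleftrightarrow> (\<forall>f\<in>\<F>. \<forall>g\<in>\<F>.
      quadrature x p (deriv_on a b (\<lambda>t. f t * g t)) = integral {a..b} (deriv_on a b (\<lambda>t. f t * g t)))"
    unfolding exact_quadrature_def product_derivs_def by blast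
  ultimately show ?thesis by simp
qed

lemma sbp_operator_imp_exact:
  assumes diff: "\<forall>f\<in>\<F>. f differentiable_on {a..b}"
    and sbp: "sbp_operator a b x \<F> D (mat_diag N (\<lambda>n. p $ n)) Q"
  shows "exact_quadrature a b x p (product_derivs a b \<F>)"
  unfolding exact_quadrature_iff[OF diff]
proof (intro ballI)
  let ?P = "mat_diag N (\<lambda>n. p $ n)"
  have dx: "dim_vec x = N" using x by simp
  obtain P' where P': "P' \<in> carrier_mat N N" "inverts_mat ?P P'" "D = P' * Q"
    and Q: "Q \<in> carrier_mat N N" "Q + transpose_mat Q = boundary_mat N"
    and D: "\<And>f. f \<in> \<F> \<Longrightarrow> D *\<^sub>v map_vec f x = map_vec (deriv_on a b f) x"
    using sbp by (auto simp: sbp_operator_def Let_def dx)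
  \<comment> \<open>Multiplying D f(x) = f'(x) by the norm matrix cancels \<open>P'\<close>.\<close>
  have Qf: "Q *\<^sub>v map_vec f x = ?P *\<^sub>v map_vec (deriv_on a b f) x" if "f \<in> \<F>" for f
  proof -
    have fx: "map_vec f x \<in> carrier_vec N" using x by simp
    have "?P *\<^sub>v map_vec (deriv_on a b f) x = (?P * (P' * Q)) *\<^sub>v map_vec f x"
      unfolding D[OF that, symmetric] P'(3)
      using P'(1) Q(1) fx by (subst assoc_mult_mat_vec[of _ N N _ N]) auto
    also have "?P * (P' * Q) = Q"
      using P'(1,2) Q(1) by (subst assoc_mult_mat[symmetric, of _ N N _ N _ N]) (auto simp: inverts_mat_def mat_diag_def)
    finally show ?thesis by simp
  qed
  \<comment> \<open>Only the function that \<open>Q\<close> acts on must lie in the space; the fact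
    is used below with both orders of \<open>f\<close> and \<open>g\<close>.\<close>
  have sum: "scalar_prod (map_vec f x) (Q *\<^sub>v map_vec g x) =
      (\<Sum>n<N. f (x $ n) * (p $ n * deriv_on a b g (x $ n)))" if "g \<in> \<F>" for f g
    using x by (auto simp: Qf[OF that] mat_diag_mult_vec[of _ N] scalar_prod_def atLeast0LessThan)
  fix f g assume f: "f \<in> \<F>" and g: "g \<in> \<F>"
  let ?f = "map_vec f x" and ?g = "map_vec g x"
  have fg: "?f \<in> carrier_vec N" "?g \<in> carrier_vec N" using x by auto
  have "scalar_prod ?f (boundary_mat N *\<^sub>v ?g) =
      scalar_prod ?f (Q *\<^sub>v ?g) + scalar_prod ?f (transpose_mat Q *\<^sub>v ?g)"
    unfolding Q(2)[symmetric] using Q(1) fg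
    by (simp add: add_mult_distrib_mat_vec[of _ N N] scalar_prod_add_distrib[of _ N])
  also have "scalar_prod ?f (transpose_mat Q *\<^sub>v ?g) = scalar_prod ?g (Q *\<^sub>v ?f)"
    using transpose_vec_mult_scalar[OF Q(1) fg] Q(1) fg
    by (subst comm_scalar_prod[of _ N]) auto
  finally show "(\<Sum>n<N. f (x $ n) * (p $ n * deriv_on a b g (x $ n))) +
      (\<Sum>n<N. g (x $ n) * (p $ n * deriv_on a b f (x $ n))) =
      scalar_prod ?f (boundary_mat N *\<^sub>v ?g)"
    using sum[OF f] sum[OF g] by simp
qed

text \<open>The completion controls only the basis functions; linearity carries the derivative
  identity to their span. Differentiability is built into the subspace \<open>?S\<close> because
  additivity of \<open>deriv_on\<close> relies on it.\<close>

lemma deriv_on_grid_span: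
  assumes D: "D \<in> carrier_mat N N"
    and diff: "\<And>f. f \<in> B \<Longrightarrow> f differentiable_on {a..b}"
    and eq: "\<And>f. f \<in> B \<Longrightarrow> D *\<^sub>v map_vec f x = map_vec (deriv_on a b f) x"
    and f: "f \<in> fun_space.span B"
  shows "D *\<^sub>v map_vec f x = map_vec (deriv_on a b f) x"
proof -
  let ?S = "{f. f differentiable_on {a..b} \<and> D *\<^sub>v map_vec f x = map_vec (deriv_on a b f) x}"
  have "fun_space.subspace ?S"
  proof (rule fun_space.subspaceI)
    have "deriv_on a b 0 t = 0" if "t \<in> {a..b}" for t
      by (intro deriv_on_eqI[OF ab that]) (simp add: zero_fun_def)
    then have "map_vec (deriv_on a b 0) x = 0\<^sub>v N"
      using x x_in by (intro eq_vecI) auto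
    moreover have "map_vec (0 :: real \<Rightarrow> real) x = 0\<^sub>v N" using x by (intro eq_vecI) auto
    moreover have "D *\<^sub>v 0\<^sub>v N = 0\<^sub>v N" using D by (intro eq_vecI) auto
    ultimately show "0 \<in> ?S" by (simp add: zero_fun_def)
  next
    fix f g assume fg: "f \<in> ?S" "g \<in> ?S"
    have "deriv_on a b (f + g) t = deriv_on a b f t + deriv_on a b g t" if "t \<in> {a..b}" for t
      unfolding plus_fun_def using fg that
      by (intro deriv_on_eqI[OF ab that] has_vector_derivative_add has_vector_derivative_deriv_on) auto
    then have "map_vec (deriv_on a b (f + g)) x = map_vec (deriv_on a b f) x + map_vec (deriv_on a b g) x"
      using x x_in by (intro eq_vecI) auto
    moreover have "map_vec (f + g) x = map_vec f x + map_vec g x" using x by (intro eq_vecI) auto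
    moreover have "(f + g) differentiable_on {a..b}"
      using fg unfolding plus_fun_def by (auto intro: differentiable_on_add)
    ultimately show "f + g \<in> ?S"
      using fg D x by (auto simp: mult_add_distrib_mat_vec[of _ N N])
  next
    fix c f assume f: "f \<in> ?S"
    have "deriv_on a b (\<lambda>t. c * f t) t = c * deriv_on a b f t" if "t \<in> {a..b}" for t
      using f that
      by (intro deriv_on_eqI[OF ab that] has_vector_derivative_mult_right has_vector_derivative_deriv_on) auto
    then have "map_vec (deriv_on a b (\<lambda>t. c * f t)) x = c \<cdot>\<^sub>v map_vec (deriv_on a b f) x"
      using x x_in by (intro eq_vecI) auto
    moreover have "map_vec (\<lambda>t. c * f t) x = c \<cdot>\<^sub>v map_vec f x" using x by (intro eq_vecI) auto
    moreover have "(\<lambda>t. c * f t) differentiable_on {a..b}"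
      using f by (auto simp: differentiable_on_def intro!: differentiable_mult)
    ultimately show "(\<lambda>t. c * f t) \<in> ?S"
      using f D x by (auto simp: mult_mat_vec[of _ N N])
  qed
  then have "fun_space.span B \<subseteq> ?S"
    using diff eq by (intro fun_space.span_minimal) auto
  then show ?thesis using f by auto
qed

lemma exact_imp_sbp_operator:
  assumes diff: "\<forall>f\<in>\<F>. f differentiable_on {a..b}"
    and span: "fun_space.span (set fs) = \<F>"
    and li: "lin_indpt_cols (vandermonde_like fs x)"
    and pos: "\<And>n. n < N \<Longrightarrow> p $ n > 0"
    and exact: "exact_quadrature a b x p (product_derivs a b \<F>)"
  obtains D Q where "sbp_operator a b x \<F> D (mat_diag N (\<lambda>n. p $ n)) Q"
proof -
  let ?K = "length fs" and ?F = "vandermonde_like fs x" and ?B = "boundary_mat N"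
  let ?P = "mat_diag N (\<lambda>n. p $ n)" and ?P' = "mat_diag N (\<lambda>n. 1 / p $ n)"
  have dx: "dim_vec x = N" using x by simp
  have fs: "f \<in> \<F>" if "f \<in> set fs" for f
    using that span fun_space.span_base by auto
  have F: "?F \<in> carrier_mat N ?K" by (simp add: vandermonde_like_def dx)
  have B: "?B \<in> carrier_mat N N" by (simp add: boundary_mat_def)
  have colF: "col ?F k = map_vec (fs ! k) x" if "k < ?K" for k
    using that by (intro eq_vecI) (auto simp: vandermonde_like_def dx)
  \<comment> \<open>The value that \<open>S\<close> must take at the grid vector of the k-th basis
    function so that Q = S + B/2 sends it to P times the grid vector of its derivative.\<close>
  define r where "r k = ?P *\<^sub>v map_vec (deriv_on a b (fs ! k)) x
    - (1/2) \<cdot>\<^sub>v (?B *\<^sub>v map_vec (fs ! k) x)" for k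
  define R where "R = Matrix.mat N ?K (\<lambda>(n, k). r k $ n)"
  have fc: "map_vec (fs ! k) x \<in> carrier_vec N" for k using x by simp
  have Bf: "?B *\<^sub>v map_vec (fs ! k) x \<in> carrier_vec N" for k
    by (rule mult_mat_vec_carrier[OF B fc])
  have Pf: "?P *\<^sub>v map_vec (deriv_on a b (fs ! k)) x \<in> carrier_vec N" for k
    using x by (intro mult_mat_vec_carrier[OF mat_diag_dim]) simp
  have r: "r k \<in> carrier_vec N" for k
    unfolding r_def by (intro minus_carrier_vec smult_carrier_vec[THEN iffD2] Bf Pf)
  have R: "R \<in> carrier_mat N ?K" by (simp add: R_def)
  have colR: "col R k = r k" if "k < ?K" for k
    using that r[of k] by (intro eq_vecI) (auto simp: R_def)
  \<comment> \<open>Exactness for pairs of basis functions, rewritten as skewness of R^T F. The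
    boundary form is symmetric, so the halves subtracted in \<open>r i\<close> and
    \<open>r j\<close> add up to the whole boundary term.\<close>
  have fr: "scalar_prod (map_vec (fs ! i) x) (r j) + scalar_prod (map_vec (fs ! j) x) (r i) = 0"
    if ij: "i < ?K" "j < ?K" for i j
  proof -
    let ?f = "\<lambda>i. map_vec (fs ! i) x"
    have *: "scalar_prod (?f i) (r j) =
        (\<Sum>n<N. (fs ! i) (x $ n) * (p $ n * deriv_on a b (fs ! j) (x $ n)))
        - scalar_prod (?f i) (?B *\<^sub>v ?f j) / 2" for i j
    proof -
      have "scalar_prod (?f i) (r j) =
        scalar_prod (?f i) (?P *\<^sub>v map_vec (deriv_on a b (fs ! j)) x)
        - scalar_prod (?f i) (?B *\<^sub>v ?f j) / 2"
        unfolding r_def using Bf[of j] Pf[of j] fc[of i]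
        by (subst scalar_prod_minus_distrib[of _ N]) auto
      moreover have "scalar_prod (?f i) (?P *\<^sub>v map_vec (deriv_on a b (fs ! j)) x) =
          (\<Sum>n<N. (fs ! i) (x $ n) * (p $ n * deriv_on a b (fs ! j) (x $ n)))"
        using x by (auto simp: mat_diag_mult_vec[of _ N] scalar_prod_def atLeast0LessThan)
      ultimately show ?thesis by simp
    qed
    have "scalar_prod (?f i) (?B *\<^sub>v ?f j) = scalar_prod (?f j) (?B *\<^sub>v ?f i)"
      using N_ge_2 fc by (simp add: scalar_prod_boundary_mat)
    moreover have "(\<Sum>n<N. (fs ! i) (x $ n) * (p $ n * deriv_on a b (fs ! j) (x $ n))) +
        (\<Sum>n<N. (fs ! j) (x $ n) * (p $ n * deriv_on a b (fs ! i) (x $ n))) =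
        scalar_prod (?f i) (?B *\<^sub>v ?f j)"
      using exact[unfolded exact_quadrature_iff[OF diff]] fs[OF nth_mem[OF ij(1)]] fs[OF nth_mem[OF ij(2)]]
      by blast
    ultimately show ?thesis unfolding * by (simp add: field_simps)
  qed
  have "transpose_mat (transpose_mat R * ?F) = - (transpose_mat R * ?F)"
  proof (rule eq_matI)
    fix i j assume "i < dim_row (- (transpose_mat R * ?F))" "j < dim_col (- (transpose_mat R * ?F))"
    then have ij: "i < ?K" "j < ?K" using R F by auto
    have "scalar_prod (r j) (map_vec (fs ! i) x) = - scalar_prod (r i) (map_vec (fs ! j) x)"
      using fr[OF ij] comm_scalar_prod[OF r, of "map_vec (fs ! i) x" j]
        comm_scalar_prod[OF r, of "map_vec (fs ! j) x" i] x by simp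
    then show "transpose_mat (transpose_mat R * ?F) $$ (i, j) = (- (transpose_mat R * ?F)) $$ (i, j)"
      using ij R F by (simp add: colR colF)
  qed (use R F in auto)
  then obtain S where S: "S \<in> carrier_mat N N" "transpose_mat S = - S" "S * ?F = R"
    using skew_completion[OF F R li] by blast
  \<comment> \<open>The symmetric part of \<open>Q\<close> is prescribed as half the boundary
    matrix; the skew part \<open>S\<close> is what remained free.\<close>
  define Q where "Q = S + (1/2) \<cdot>\<^sub>m ?B"
  have Q: "Q \<in> carrier_mat N N" using S B by (simp add: Q_def)
  \<comment> \<open>Positive weights are nonzero, so the reciprocals invert the norm matrix.\<close>
  have P'P: "?P' * ?P = 1\<^sub>m N" "?P * ?P' = 1\<^sub>m N"
    unfolding mat_diag_diag using pos
    by (auto simp: mat_diag_def less_imp_neq[symmetric] intro!: eq_matI)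
  have Qf: "Q *\<^sub>v map_vec (fs ! k) x = ?P *\<^sub>v map_vec (deriv_on a b (fs ! k)) x" if k: "k < ?K" for k
  proof -
    have fk: "map_vec (fs ! k) x \<in> carrier_vec N" using x by simp
    have "S *\<^sub>v map_vec (fs ! k) x = r k"
      using S(3) col_mult2[OF S(1) F k] colF[OF k] colR[OF k] by simp
    then have "Q *\<^sub>v map_vec (fs ! k) x = r k + (1/2) \<cdot>\<^sub>v (?B *\<^sub>v map_vec (fs ! k) x)"
      unfolding Q_def using S(1) B fk
      by (subst add_mult_distrib_mat_vec[of _ N N]) (auto simp: smult_mat_mult_vec[of _ N N])
    also have "\<dots> = ?P *\<^sub>v map_vec (deriv_on a b (fs ! k)) x"
      \<comment> \<open>The half boundary term subtracted in \<open>r k\<close> cancels the one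
        added in \<open>Q\<close>.\<close>
      unfolding r_def using B by (intro eq_vecI) (auto simp: mat_diag_def)
    finally show ?thesis .
  qed
  have D: "?P' * Q \<in> carrier_mat N N" using Q by (auto simp: mat_diag_def)
  have "(?P' * Q) *\<^sub>v map_vec f x = map_vec (deriv_on a b f) x" if "f \<in> set fs" for f
  proof -
    obtain k where k: "k < ?K" "f = fs ! k" using \<open>f \<in> set fs\<close> by (metis in_set_conv_nth)
    have "(?P' * Q) *\<^sub>v map_vec f x = ?P' *\<^sub>v (?P *\<^sub>v map_vec (deriv_on a b f) x)"
      using Qf[OF k(1)] k(2) Q x by (subst assoc_mult_mat_vec[of _ N N _ N]) auto
    also have "\<dots> = (?P' * ?P) *\<^sub>v map_vec (deriv_on a b f) x"
      using x by (subst assoc_mult_mat_vec[of _ N N _ N]) auto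
    also have "\<dots> = map_vec (deriv_on a b f) x"
      using x by (simp only: P'P) simp
    finally show ?thesis .
  qed
  then have "\<forall>f\<in>\<F>. (?P' * Q) *\<^sub>v map_vec f x = map_vec (deriv_on a b f) x"
    using deriv_on_grid_span[OF D, of "set fs"] diff fs span by blast
  moreover have "Q + transpose_mat Q = ?B"
  proof (rule eq_matI)
    fix i j assume ij: "i < dim_row ?B" "j < dim_col ?B"
    have "S $$ (j, i) = - S $$ (i, j)"
      using arg_cong[OF S(2), of "\<lambda>Y. Y $$ (i, j)"] S(1) B ij by simp
    moreover have "?B $$ (j, i) = ?B $$ (i, j)"
      using ij by (auto simp: boundary_mat_def mat_diag_def)
    ultimately show "(Q + transpose_mat Q) $$ (i, j) = ?B $$ (i, j)"
      using ij S(1) B by (simp add: Q_def)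
  qed (use Q B in auto)
  moreover have "sym_pos_def ?P" using pos by (simp add: sym_pos_def_mat_diag_iff)
  ultimately have "sbp_operator a b x \<F> (?P' * Q) ?P Q"
    unfolding sbp_operator_def Let_def dx using Q P'P
    by (auto simp: inverts_mat_def mat_diag_def intro!: bexI[of _ ?P'])
  then show thesis by (rule that)
qed

lemma diagonal_sbp_operator_iff:
  assumes diff: "\<forall>f\<in>\<F>. f differentiable_on {a..b}"
    and span: "fun_space.span (set fs) = \<F>"
    and li: "lin_indpt_cols (vandermonde_like fs x)"
    and p: "p \<in> carrier_vec N"
  shows "(\<exists>D Q. sbp_operator a b x \<F> D (mat_diag N (\<lambda>n. p $ n)) Q) \<longleftrightarrow>
    positive_quadrature p \<and> exact_quadrature a b x p (product_derivs a b \<F>)"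
proof
  assume "\<exists>D Q. sbp_operator a b x \<F> D (mat_diag N (\<lambda>n. p $ n)) Q"
  then obtain D Q where sbp: "sbp_operator a b x \<F> D (mat_diag N (\<lambda>n. p $ n)) Q" by blast
  then have "sym_pos_def (mat_diag N (\<lambda>n. p $ n))"
    by (auto simp: sbp_operator_def Let_def)
  then have "positive_quadrature p"
    using p by (simp add: sym_pos_def_mat_diag_iff positive_quadrature_def)
  with sbp_operator_imp_exact[OF diff sbp]
  show "positive_quadrature p \<and> exact_quadrature a b x p (product_derivs a b \<F>)" by blast
next
  assume *: "positive_quadrature p \<and> exact_quadrature a b x p (product_derivs a b \<F>)"
  then have "p $ n > 0" if "n < N" for n
    using that p by (auto simp: positive_quadrature_def)
  with * exact_imp_sbp_operator[OF diff span li]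
  show "\<exists>D Q. sbp_operator a b x \<F> D (mat_diag N (\<lambda>n. p $ n)) Q" by metis
qed

end

theorem corollary4p6:
  fixes xL xR :: real and N K :: nat and x p :: "real vec"
    and \<F> :: "(real \<Rightarrow> real) set" and fs :: "(real \<Rightarrow> real) list"
  assumes "xL < xR"
    and "N \<ge> 1" and "x \<in> carrier_vec N"
    and "\<forall>n<N. x $ n \<in> {xL..xR}" and "x $ 0 = xL" and "x $ (N - 1) = xR"
    and "\<F> \<subseteq> C1_on xL xR"
    and "length fs = K" and "is_basis fs \<F>"
    and "lin_indpt_cols (vandermonde_like fs x)"
    and "p \<in> carrier_vec N"
  shows "((\<exists>D Q. sbp_operator xL xR x \<F> D (mat_diag N (\<lambda>n. p $ n)) Q) \<longleftrightarrow>
            positive_quadrature p \<and>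
            exact_quadrature xL xR x p (product_derivs xL xR \<F>)) \<and>
         ((\<exists>D P Q. sbp_operator xL xR x \<F> D P Q \<and> diagonal_mat P) \<longleftrightarrow>
            (\<exists>w\<in>carrier_vec N. positive_quadrature w \<and>
               exact_quadrature xL xR x w (product_derivs xL xR \<F>)))"
proof -
  interpret grid xL xR N x
    using assms by unfold_locales auto
  have diff: "\<forall>f\<in>\<F>. f differentiable_on {xL..xR}"
    using assms(7) by (auto simp: C1_on_def)
  have span: "fun_space.span (set fs) = \<F>"
    using assms(9) by (simp add: is_basis_def)
  note iff = diagonal_sbp_operator_iff[OF diff span assms(10)]
  \<comment> \<open>The existence statement follows from the equivalence for fixed weights once a
    diagonal norm matrix is traded for a weight vector.\<close>
  have "(\<exists>D P Q. sbp_operator xL xR x \<F> D P Q \<and> diagonal_mat P) \<longleftrightarrow>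
    (\<exists>w\<in>carrier_vec N. \<exists>D Q. sbp_operator xL xR x \<F> D (mat_diag N (\<lambda>n. w $ n)) Q)"
  proof safe
    fix D P Q assume sbp: "sbp_operator xL xR x \<F> D P Q" and diag: "diagonal_mat P"
    have P: "P \<in> carrier_mat N N" using sbp x by (auto simp: sbp_operator_def Let_def)
    \<comment> \<open>The weights are the diagonal entries of \<open>P\<close>, packed into a vector
      so that the equivalence for fixed weights applies.\<close>
    have "P = mat_diag N (\<lambda>n. vec N (\<lambda>n. P $$ (n, n)) $ n)"
      using P diag by (intro eq_matI) (auto simp: mat_diag_def diagonal_mat_def)
    with sbp show "\<exists>w\<in>carrier_vec N. \<exists>D Q. sbp_operator xL xR x \<F> D (mat_diag N (\<lambda>n. w $ n)) Q"
      by (metis vec_carrier)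
  next
    fix w :: "real vec" and D Q
    assume "sbp_operator xL xR x \<F> D (mat_diag N (\<lambda>n. w $ n)) Q"
    moreover have "diagonal_mat (mat_diag N (\<lambda>n. w $ n))"
      by (simp add: diagonal_mat_def mat_diag_def)
    ultimately show "\<exists>D P Q. sbp_operator xL xR x \<F> D P Q \<and> diagonal_mat P" by blast
  qed
  then show ?thesis
    using iff \<open>p \<in> carrier_vec N\<close> by blast
qed

end
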